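(* Let $G_w$ be a weighted $\theta$-graph of order $n$ having at least one pendant vertex. Then $i_+(G_w)\ge 2$, $i_-(G_w)\ge 2$ and $i_0(G_w)\le n-4$.
   Context: A weighted graph $G_w$ is a simple graph $G$ with a positive weight on each edge; its adjacency matrix has entry $w(v_iv_j)$ if $v_iv_j\in E(G)$ and $0$ otherwise, and $i_+(G_w)$, $i_-(G_w)$, $i_0(G_w)$ are the numbers of positive, negative, zero eigenvalues of this matrix, with multiplicity. A bicyclic graph is a connected simple graph with $|E|=|V|+1$; its base is its unique bicyclic subgraph with no pendant vertices. For integers $p,l,q\ge 0$ with at most one of them equal to $0$, $\theta(p,l,q)$ is the graph consisting of two vertices $u,v$ joined by three internally vertex-disjoint paths with $p$, $l$ and $q$ internal vertices respectively (a path with $0$ internal vertices is the edge $uv$). A (weighted) $\theta$-graph is a (weighted) bicyclic graph whose base is $\theta(p,l,q)$ for some such $p,l,q$. *)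

theory Defs
  imports "Jordan_Normal_Form.Char_Poly" "HOL-Library.Ramsey"
begin

text \<open>A simple graph is a finite vertex set \<open>V\<close> together with a set \<open>E\<close> of two-element
  subsets of \<open>V\<close>.\<close>

definition simple_graph :: "'a set \<Rightarrow> 'a set set \<Rightarrow> bool" where
  "simple_graph V E \<longleftrightarrow> finite V \<and> E \<subseteq> nsets V 2"

definition graph_connected :: "'a set \<Rightarrow> 'a set set \<Rightarrow> bool" where
  "graph_connected V E \<longleftrightarrow> V \<noteq> {} \<and> (\<forall>x\<in>V. \<forall>y\<in>V. (x, y) \<in> {(a, b). {a, b} \<in> E}\<^sup>*)"

definition bicyclic :: "'a set \<Rightarrow> 'a set set \<Rightarrow> bool" where
  "bicyclic V E \<longleftrightarrow> simple_graph V E \<and> graph_connected V E \<and> card E = card V + 1"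

definition pendant_vertex :: "'a set \<Rightarrow> 'a set set \<Rightarrow> 'a \<Rightarrow> bool" where
  "pendant_vertex V E x \<longleftrightarrow> x \<in> V \<and> card {e \<in> E. x \<in> e} = 1"

definition is_subgraph :: "'a set \<Rightarrow> 'a set set \<Rightarrow> 'a set \<Rightarrow> 'a set set \<Rightarrow> bool" where
  "is_subgraph V' E' V E \<longleftrightarrow> simple_graph V' E' \<and> V' \<subseteq> V \<and> E' \<subseteq> E"

text \<open>\<open>(V', E')\<close> is the base of \<open>(V, E)\<close>. A bicyclic graph has exactly one such subgraph,
  so a relation is enough.\<close>

definition is_base :: "'a set \<Rightarrow> 'a set set \<Rightarrow> 'a set \<Rightarrow> 'a set set \<Rightarrow> bool" where
  "is_base V' E' V E \<longleftrightarrow>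
     is_subgraph V' E' V E \<and> bicyclic V' E' \<and> (\<nexists>x. pendant_vertex V' E' x)"

definition graph_isomorphic ::
    "'a set \<Rightarrow> 'a set set \<Rightarrow> 'b set \<Rightarrow> 'b set set \<Rightarrow> bool" where
  "graph_isomorphic V E V' E' \<longleftrightarrow>
     (\<exists>f. bij_betw f V V' \<and> (\<forall>x\<in>V. \<forall>y\<in>V. {x, y} \<in> E \<longleftrightarrow> {f x, f y} \<in> E'))"

text \<open>\<open>End_u\<close> and \<open>End_v\<close> are the two ends common to the three paths; \<open>Inner i j\<close> is the
  \<open>j\<close>-th internal vertex (\<open>j = 1, 2, \<dots>\<close>, counted from \<open>End_u\<close>) of path number \<open>i\<close>.
  A path with \<open>k\<close> internal vertices visits \<open>path_node k i 0, \<dots>, path_node k i (k + 1)\<close>.\<close>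

datatype theta_node = End_u | End_v | Inner nat nat

definition path_node :: "nat \<Rightarrow> nat \<Rightarrow> nat \<Rightarrow> theta_node" where
  "path_node k i j = (if j = 0 then End_u else if j = k + 1 then End_v else Inner i j)"

definition path_verts :: "nat \<Rightarrow> nat \<Rightarrow> theta_node set" where
  "path_verts k i = path_node k i ` {0..k + 1}"

definition path_edges :: "nat \<Rightarrow> nat \<Rightarrow> theta_node set set" where
  "path_edges k i = (\<lambda>j. {path_node k i j, path_node k i (j + 1)}) ` {0..k}"

definition theta_verts :: "nat \<Rightarrow> nat \<Rightarrow> nat \<Rightarrow> theta_node set" where
  "theta_verts p l q = path_verts p 0 \<union> path_verts l 1 \<union> path_verts q 2"

definition theta_edges :: "nat \<Rightarrow> nat \<Rightarrow> nat \<Rightarrow> theta_node set set" where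
  "theta_edges p l q = path_edges p 0 \<union> path_edges l 1 \<union> path_edges q 2"

definition at_most_one_zero :: "nat \<Rightarrow> nat \<Rightarrow> nat \<Rightarrow> bool" where
  "at_most_one_zero p l q \<longleftrightarrow> \<not> (p = 0 \<and> l = 0) \<and> \<not> (p = 0 \<and> q = 0) \<and> \<not> (l = 0 \<and> q = 0)"

definition theta_graph :: "'a set \<Rightarrow> 'a set set \<Rightarrow> bool" where
  "theta_graph V E \<longleftrightarrow> bicyclic V E \<and>
     (\<exists>p l q V' E'. at_most_one_zero p l q \<and> is_base V' E' V E \<and>
        graph_isomorphic (theta_verts p l q) (theta_edges p l q) V' E')"

definition weighted_graph :: "'a set \<Rightarrow> 'a set set \<Rightarrow> ('a set \<Rightarrow> real) \<Rightarrow> bool" where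
  "weighted_graph V E w \<longleftrightarrow> simple_graph V E \<and> (\<forall>e\<in>E. w e > 0)"

definition weighted_theta_graph :: "'a set \<Rightarrow> 'a set set \<Rightarrow> ('a set \<Rightarrow> real) \<Rightarrow> bool" where
  "weighted_theta_graph V E w \<longleftrightarrow> weighted_graph V E w \<and> theta_graph V E"

text \<open>The list \<open>vs\<close> enumerates the vertices and thereby fixes the order of rows and columns.\<close>

definition adj_matrix :: "'a list \<Rightarrow> 'a set set \<Rightarrow> ('a set \<Rightarrow> real) \<Rightarrow> real mat" where
  "adj_matrix vs E w = mat (length vs) (length vs)
     (\<lambda>(i, j). if {vs ! i, vs ! j} \<in> E then w {vs ! i, vs ! j} else 0)"

text \<open>Numbers of positive, negative and zero eigenvalues, counted with (algebraic)
  multiplicity. They are applied to symmetric real matrices only, all of whose eigenvalues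
  are real.\<close>

definition i_pos :: "real mat \<Rightarrow> nat" where
  "i_pos A = (\<Sum>x | eigenvalue A x \<and> x > 0. order x (char_poly A))"

definition i_neg :: "real mat \<Rightarrow> nat" where
  "i_neg A = (\<Sum>x | eigenvalue A x \<and> x < 0. order x (char_poly A))"

definition i_zero :: "real mat \<Rightarrow> nat" where
  "i_zero A = (\<Sum>x | eigenvalue A x \<and> x = 0. order x (char_poly A))"

end

(* A pendant vertex x with neighbour y, together with an edge ab avoiding both, makes the form
   f \<mapsto> f^T A f definite of either sign on a plane: choosing f x suitably removes the coupling of y
   with a and b, and leaves two hyperbolic planes.  An edge ab exists because otherwise every edge
   would contain y, whereas a bicyclic graph has more edges than such a star.  By orthogonal
   diagonalisation the matrix then has at least two eigenvalues of each sign. *)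

theory Submission
  imports Defs
begin

section \<open>Orthogonal diagonalisation of real symmetric matrices\<close>

text \<open>Over the complex numbers the characteristic polynomial splits, which yields an
  eigenvalue \<open>l\<close> with eigenvector \<open>v\<close>. Symmetry makes the Hermitian form
  at \<open>v\<close> real, hence \<open>l\<close> real, and a real root of the complexified
  polynomial is a root of the original one.\<close>

lemma symmetric_real_eigenvalue_exists:
  fixes A :: "real mat"
  assumes A: "A \<in> carrier_mat n n" and sym: "transpose_mat A = A" and n: "n > 0"
  shows "\<exists>k. eigenvalue A k"
proof -
  define C where "C = map_mat complex_of_real A"
  have C: "C \<in> carrier_mat n n" using A by (auto simp: C_def)
  obtain as where as: "char_poly C = (\<Prod>a\<leftarrow>as. [:- a, 1:])" "length as = n"
    using char_poly_factorized[OF C] by blast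
  then obtain l ls where "as = l # ls" using n by (cases as) auto
  then have "poly (char_poly C) l = 0" using as by simp
  then have "eigenvalue C l" using eigenvalue_root_char_poly[OF C] by blast
  then obtain v where v: "v \<in> carrier_vec n" "v \<noteq> 0\<^sub>v n" "C *\<^sub>v v = l \<cdot>\<^sub>v v"
    using C by (auto simp: eigenvalue_def eigenvector_def)
  have a_sym: "A $$ (i, j) = A $$ (j, i)" if "i < n" "j < n" for i j
    using that A sym by (metis index_transpose_mat(1) carrier_matD)
  have ev: "(\<Sum>j<n. of_real (A $$ (i, j)) * v $ j) = l * v $ i" if "i < n" for i
  proof -
    have "(C *\<^sub>v v) $ i = (\<Sum>j<n. of_real (A $$ (i, j)) * v $ j)"
      using that A v(1) by (auto simp: C_def scalar_prod_def lessThan_atLeast0 intro!: sum.cong)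
    with v that show ?thesis by simp
  qed
  \<comment> \<open>\<open>S\<close> is the Hermitian form of \<open>C\<close> at \<open>v\<close>
    and \<open>N\<close> is the squared norm of \<open>v\<close>. The eigenvalue equation gives
    \<open>S = l * N\<close>, while swapping the two sums gives \<open>cnj S = S\<close>.\<close>
  define S where "S = (\<Sum>i<n. \<Sum>j<n. of_real (A $$ (i, j)) * (cnj (v $ i) * v $ j))"
  define N where "N = (\<Sum>i<n. (cmod (v $ i))\<^sup>2)"
  have "S = (\<Sum>i<n. cnj (v $ i) * (\<Sum>j<n. of_real (A $$ (i, j)) * v $ j))"
    unfolding S_def by (simp add: sum_distrib_left mult_ac)
  also have "\<dots> = (\<Sum>i<n. cnj (v $ i) * (l * v $ i))"
    by (simp add: ev)
  also have "\<dots> = l * of_real N"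
    by (simp add: N_def sum_distrib_left complex_norm_square mult_ac del: of_real_power)
  finally have S: "S = l * of_real N" .
  have "cnj S = (\<Sum>i<n. \<Sum>j<n. of_real (A $$ (j, i)) * (cnj (v $ j) * v $ i))"
    unfolding S_def by (auto simp: a_sym mult_ac intro!: sum.cong)
  also have "\<dots> = S"
    unfolding S_def by (rule sum.swap)
  finally have "cnj S = S" .
  moreover have "N > 0"
  proof -
    obtain i where "i < n" "v $ i \<noteq> 0"
      using v(1,2) by (metis carrier_vecD eq_vecI index_zero_vec(1,2))
    then show ?thesis unfolding N_def
      by (intro sum_pos2[of _ i]) auto
  qed
  ultimately have "cnj l = l" using S by simp
  then have l: "l = of_real (Re l)" by (metis Reals_cnj_iff of_real_Re)
  have "poly (char_poly C) l = of_real (poly (char_poly A) (Re l))"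
    unfolding C_def by (subst l) (simp add: of_real_hom.char_poly_hom[OF A])
  then have "poly (char_poly A) (Re l) = 0"
    using \<open>poly (char_poly C) l = 0\<close> by simp
  then show ?thesis using eigenvalue_root_char_poly[OF A] by blast
qed

text \<open>The matrix is the Householder reflection exchanging \<open>v\<close> and the first unit vector.\<close>

lemma reflection_exists:
  fixes v :: "real vec"
  assumes v: "v \<in> carrier_vec n" and unit: "v \<bullet> v = 1" and n: "n > 0"
  shows "\<exists>H \<in> carrier_mat n n. transpose_mat H = H \<and> H * H = 1\<^sub>m n
           \<and> H *\<^sub>v unit_vec n 0 = v"
proof (cases "v = unit_vec n 0")
  case True
  then show ?thesis using v by (intro bexI[of _ "1\<^sub>m n"]) auto
next
  case False
  define u where "u i = v $ i - (if i = 0 then 1 else 0)" for i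
  have v1: "(\<Sum>i<n. (v $ i)\<^sup>2) = 1"
    using unit v by (simp add: scalar_prod_def lessThan_atLeast0 power2_eq_square)
  have "(\<Sum>i<n. (u i)\<^sup>2) = (\<Sum>i<n. (v $ i)\<^sup>2 + (if i = 0 then 1 - 2 * v $ 0 else 0))"
    by (auto simp: u_def power2_eq_square algebra_simps intro!: sum.cong)
  also have "\<dots> = 2 * (1 - v $ 0)"
    using n by (simp add: sum.distrib v1)
  finally have uu: "(\<Sum>i<n. (u i)\<^sup>2) = 2 * (1 - v $ 0)" .
  have v0: "v $ 0 \<noteq> 1"
  proof
    assume "v $ 0 = 1"
    then have "\<forall>i\<in>{..<n}. (u i)\<^sup>2 = 0"
      using uu by (simp add: sum_nonneg_eq_0_iff)
    then have "v = unit_vec n 0"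
      using v by (intro eq_vecI) (auto simp: u_def)
    with False show False ..
  qed
  \<comment> \<open>The factor 2 / |u|^2 of the reflection along \<open>u\<close>, simplified by
    \<open>uu\<close>.\<close>
  define c where "c = 1 / (1 - v $ 0)"
  define H where "H = mat n n (\<lambda>(i, j). (if i = j then 1 else 0) - c * u i * u j)"
  have H: "H \<in> carrier_mat n n" by (simp add: H_def)
  have "transpose_mat H = H" by (rule eq_matI) (auto simp: H_def)
  moreover have "H * H = 1\<^sub>m n"
  proof (rule eq_matI)
    fix i j assume "i < dim_row (1\<^sub>m n :: real mat)" "j < dim_col (1\<^sub>m n :: real mat)"
    then have ij: "i < n" "j < n" by auto
    have "(H * H) $$ (i, j) = (\<Sum>k<n. ((if i = k then 1 else 0) - c * u i * u k)
        * ((if k = j then 1 else 0) - c * u k * u j))"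
      using ij by (auto simp: H_def scalar_prod_def lessThan_atLeast0 intro!: sum.cong)
    \<comment> \<open>Each Kronecker delta collapses the sum over \<open>k\<close>. The corrections
      to the identity cancel because c |u|^2 = 2.\<close>
    also have "\<dots> = (\<Sum>k<n. (if k = i then (if i = j then 1 else 0) - c * u i * u j else 0)
        - (if k = j then c * u i * u j else 0) + c * c * u i * u j * (u k)\<^sup>2)"
      by (rule sum.cong) (auto simp: power2_eq_square algebra_simps)
    also have "\<dots> = (if i = j then 1 else 0) - 2 * c * u i * u j
        + c * c * u i * u j * (2 * (1 - v $ 0))"
      using ij by (simp add: sum.distrib sum_subtractf sum_distrib_left[symmetric] uu)
    also have "\<dots> = (if i = j then 1 else 0) - 2 * c * u i * u j * (1 - c * (1 - v $ 0))"
      by (simp add: algebra_simps)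
    also have "\<dots> = (if i = j then 1 else 0)"
      using v0 by (simp add: c_def)
    finally show "(H * H) $$ (i, j) = 1\<^sub>m n $$ (i, j)" using ij by simp
  qed (auto simp: H_def)
  moreover have "H *\<^sub>v unit_vec n 0 = v"
  proof (rule eq_vecI)
    fix i assume "i < dim_vec v"
    then have i: "i < n" using v by simp
    then have "(H *\<^sub>v unit_vec n 0) $ i = H $$ (i, 0)"
      using n H by simp
    \<comment> \<open>As \<open>- c * u 0 = 1\<close>, the first column of \<open>H\<close> is the
      first unit vector plus \<open>u\<close>, which is \<open>v\<close>.\<close>
    also have "\<dots> = v $ i"
      using v0 i n by (auto simp: H_def c_def u_def field_simps)
    finally show "(H *\<^sub>v unit_vec n 0) $ i = v $ i" .
  qed (use v H in auto)
  ultimately show ?thesis using H by blast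
qed

text \<open>Induction by deflation: conjugating with a reflection that moves the first unit vector
  to a unit eigenvector splits off a 1 by 1 block, and the induction hypothesis handles the rest.
  The reflection is symmetric and its own inverse, so the accumulated change of basis stays
  orthogonal.\<close>

theorem real_spectral_theorem:
  fixes A :: "real mat"
  assumes "A \<in> carrier_mat n n" and "transpose_mat A = A"
  shows "\<exists>P D. similar_mat_wit A D P (transpose_mat P) \<and> diagonal_mat D"
  using assms
proof (induction n arbitrary: A)
  case 0
  then have "similar_mat_wit A A (1\<^sub>m 0) (transpose_mat (1\<^sub>m 0))"
    by (intro similar_mat_witI[of _ _ 0]) auto
  moreover have "diagonal_mat A" using 0 by (auto simp: diagonal_mat_def)
  ultimately show ?case by blast
next
  case (Suc m A)
  let ?n = "Suc m"
  note A = Suc.prems(1) and sym = Suc.prems(2)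
  obtain k where "eigenvalue A k"
    using symmetric_real_eigenvalue_exists[OF A sym] by auto
  then obtain x where x: "x \<in> carrier_vec ?n" "x \<noteq> 0\<^sub>v ?n" "A *\<^sub>v x = k \<cdot>\<^sub>v x"
    using A by (auto simp: eigenvalue_def eigenvector_def)
  have xx: "x \<bullet> x > 0"
    using conjugate_square_greater_0_vec[OF x(1)] x(2) by simp
  define v where "v = (1 / sqrt (x \<bullet> x)) \<cdot>\<^sub>v x"
  have v: "v \<in> carrier_vec ?n" using x by (simp add: v_def)
  have "v \<bullet> v = 1" using xx x(1) by (simp add: v_def)
  have Av: "A *\<^sub>v v = k \<cdot>\<^sub>v v"
    unfolding v_def using A x by (simp add: mult_mat_vec smult_smult_assoc mult.commute)
  obtain H where H: "H \<in> carrier_mat ?n ?n" "transpose_mat H = H" "H * H = 1\<^sub>m ?n"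
    "H *\<^sub>v unit_vec ?n 0 = v"
    using reflection_exists[OF v \<open>v \<bullet> v = 1\<close>] by auto
  define B where "B = H * A * H"
  have B: "B \<in> carrier_mat ?n ?n" using H A by (auto simp: B_def)
  have B_sym: "transpose_mat B = B"
    unfolding B_def using H(1,2) A sym
    by (simp add: transpose_mult[of _ ?n ?n _ ?n] assoc_mult_mat[of _ ?n ?n _ ?n _ ?n])
  \<comment> \<open>\<open>H\<close> is an involution, so it also sends \<open>v\<close> back; hence
    the first unit vector is an eigenvector of \<open>B\<close> for \<open>k\<close>.\<close>
  have "H *\<^sub>v v = unit_vec ?n 0"
    using H(1,3,4) by (metis assoc_mult_mat_vec one_mult_mat_vec unit_vec_carrier)
  then have "B *\<^sub>v unit_vec ?n 0 = k \<cdot>\<^sub>v unit_vec ?n 0"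
    unfolding B_def using H A v Av
    by (simp add: assoc_mult_mat_vec[of _ ?n ?n _ ?n] mult_mat_vec[of _ ?n ?n])
  moreover have "(B *\<^sub>v unit_vec ?n 0) $ i = B $$ (i, 0)" if "i < ?n" for i
    using that B by simp
  ultimately have B_col: "B $$ (i, 0) = (if i = 0 then k else 0)" if "i < ?n" for i
    using that by (metis index_smult_vec(1) index_unit_vec(1,3) mult.right_neutral mult_zero_right zero_less_Suc)
  \<comment> \<open>Symmetry transfers the zeros of the first column to the first row, so
    \<open>B\<close> is block diagonal.\<close>
  then have B_row: "B $$ (0, i) = (if i = 0 then k else 0)" if "i < ?n" for i
    using that B B_sym by (metis index_transpose_mat(1) carrier_matD zero_less_Suc)
  define K where "K = mat 1 1 (\<lambda>_. k)"
  define C where "C = mat m m (\<lambda>(i, j). B $$ (Suc i, Suc j))"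
  have K: "K \<in> carrier_mat 1 1" and C: "C \<in> carrier_mat m m"
    by (simp_all add: K_def C_def)
  have block: "B = four_block_mat K (0\<^sub>m 1 m) (0\<^sub>m m 1) C"
    by (rule eq_matI) (use B B_col B_row in \<open>auto simp: K_def C_def\<close>)
  have "transpose_mat C = C"
    by (rule eq_matI) (use B B_sym in \<open>auto simp: C_def, metis Suc_less_eq index_transpose_mat(1) carrier_matD\<close>)
  from Suc.IH[OF C this] obtain P D
    where PD: "similar_mat_wit C D P (transpose_mat P)" "diagonal_mat D" by blast
  note PDc = similar_mat_witD2[OF C PD(1)]
  define P' where "P' = four_block_mat (1\<^sub>m 1) (0\<^sub>m 1 m) (0\<^sub>m m 1) P"
  define D' where "D' = four_block_mat K (0\<^sub>m 1 m) (0\<^sub>m m 1) D"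
  have P': "P' \<in> carrier_mat ?n ?n" using PDc by (auto simp: P'_def)
  have P'_tr: "transpose_mat P' = four_block_mat (1\<^sub>m 1) (0\<^sub>m 1 m) (0\<^sub>m m 1) (transpose_mat P)"
    unfolding P'_def using PDc by (subst transpose_four_block_mat[of _ 1 1 _ m _ m]) auto
  have "similar_mat_wit B D' P' (transpose_mat P')"
    unfolding P'_tr unfolding block P'_def D'_def
    by (rule similar_mat_wit_four_block[OF similar_mat_wit_refl[OF K] PD(1) _ _ K C])
       (use PDc in auto)
  moreover have "similar_mat_wit A B H H"
  proof (rule similar_mat_witI[of _ _ ?n])
    have "H * B * H = (H * H) * A * (H * H)"
      unfolding B_def using H(1) A by (simp add: assoc_mult_mat[of _ ?n ?n _ ?n _ ?n])
    then show "A = H * B * H" using H A by simp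
  qed (use H A B in auto)
  ultimately have "similar_mat_wit A D' (H * P') (transpose_mat P' * H)"
    using similar_mat_wit_trans by blast
  moreover have "transpose_mat P' * H = transpose_mat (H * P')"
    using transpose_mult[OF H(1) P'] H(2) by simp
  moreover have "diagonal_mat D'"
    using PD(2) PDc K by (auto simp: diagonal_mat_def D'_def)
  ultimately show ?case by metis
qed

section \<open>Eigenvalue multiplicities read off a diagonal form\<close>

lemma order_prod_linear_factors:
  fixes as :: "'a :: idom list"
  shows "order x (\<Prod>a\<leftarrow>as. [:- a, 1:]) = count_list as x"
proof (induction as)
  case (Cons a as)
  have "(\<Prod>a\<leftarrow>a # as. [:- a, 1:]) \<noteq> 0"
    unfolding prod_list_zero_iff by auto
  then have "order x (\<Prod>a\<leftarrow>a # as. [:- a, 1:]) = order x [:- a, 1:] + count_list as x"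
    using Cons.IH by (simp add: order_mult del: mult_pCons_left)
  moreover have "order x [:- a, 1:] = (if a = x then 1 else 0)"
    using order_power_n_n[of a 1] by (auto intro: order_0I)
  ultimately show ?case by simp
qed simp

lemma sum_count_list_eq_length_filter:
  "(\<Sum>x | x \<in> set as \<and> P x. count_list as x) = length (filter P as)"
proof -
  have "length (filter P as) = (\<Sum>x\<in>set (filter P as). count_list (filter P as) x)"
    by (simp add: sum_count_set)
  also have "\<dots> = (\<Sum>x | x \<in> set as \<and> P x. count_list as x)"
    by (rule sum.cong) (auto simp: count_list_eq_length_filter intro!: arg_cong[of _ _ length] filter_cong)
  finally show ?thesis by simp
qed

text \<open>Similarity preserves the characteristic polynomial, whose linear factors for
  \<open>D\<close> are given by the diagonal entries. Taking a sign condition for \<open>P\<close>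
  covers all three inertia numbers at once.\<close>

lemma sum_order_eigenvalues_diagonal:
  fixes A :: "'a :: field mat"
  assumes A: "A \<in> carrier_mat n n" and sim: "similar_mat A D" and diag: "diagonal_mat D"
  shows "(\<Sum>x | eigenvalue A x \<and> P x. order x (char_poly A)) = card {i. i < n \<and> P (D $$ (i, i))}"
proof -
  have D: "D \<in> carrier_mat n n"
    using similar_matD[OF sim] A by auto
  have "upper_triangular D"
    using D diag by (auto simp: diagonal_mat_def)
  then have cp: "char_poly A = (\<Prod>a\<leftarrow>diag_mat D. [:- a, 1:])"
    using char_poly_similar[OF sim] char_poly_upper_triangular[OF D] by simp
  have "eigenvalue A x \<longleftrightarrow> x \<in> set (diag_mat D)" for x
    unfolding eigenvalue_root_char_poly[OF A] cp
    by (auto simp: poly_prod_list prod_list_zero_iff o_def)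
  then have "(\<Sum>x | eigenvalue A x \<and> P x. order x (char_poly A)) = length (filter P (diag_mat D))"
    by (simp add: cp order_prod_linear_factors sum_count_list_eq_length_filter)
  also have "\<dots> = card {i. i < n \<and> P (D $$ (i, i))}"
    using D by (auto simp: length_filter_conv_card diag_mat_def intro!: arg_cong[of _ _ card])
  finally show ?thesis .
qed

section \<open>Inertia from planes on which the quadratic form is definite\<close>

lemma quadratic_form_diagonal:
  fixes A :: "real mat"
  assumes A: "A \<in> carrier_mat n n" and sim: "similar_mat_wit A D P (transpose_mat P)"
    and diag: "diagonal_mat D" and x: "x \<in> carrier_vec n"
  shows "x \<bullet> (A *\<^sub>v x) = (\<Sum>i<n. D $$ (i, i) * ((transpose_mat P *\<^sub>v x) $ i)\<^sup>2)"
proof -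
  note sim' = similar_mat_witD2[OF A sim]
  define y where "y = transpose_mat P *\<^sub>v x"
  have y: "y \<in> carrier_vec n" using sim' x by (simp add: y_def)
  have "x \<bullet> (A *\<^sub>v x) = x \<bullet> (P *\<^sub>v (D *\<^sub>v y))"
    unfolding y_def by (subst sim'(3)) (use sim' x in \<open>simp add: assoc_mult_mat_vec[of _ n n _ n]\<close>)
  also have "\<dots> = y \<bullet> (D *\<^sub>v y)"
    unfolding y_def using sim' x by (subst transpose_vec_mult_scalar[of _ n n]) auto
  also have "\<dots> = (\<Sum>i<n. y $ i * (D *\<^sub>v y) $ i)"
    using sim'(5) by (simp add: scalar_prod_def lessThan_atLeast0)
  also have "\<dots> = (\<Sum>i<n. D $$ (i, i) * (y $ i)\<^sup>2)"
  proof (rule sum.cong)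
    fix i assume "i \<in> {..<n}"
    then have i: "i < n" by simp
    have "(D *\<^sub>v y) $ i = (\<Sum>j<n. D $$ (i, j) * y $ j)"
      using i sim'(5) y by (auto simp: scalar_prod_def lessThan_atLeast0 intro!: sum.cong)
    also have "\<dots> = (\<Sum>j<n. if j = i then D $$ (i, i) * y $ i else 0)"
      by (rule sum.cong) (use i sim'(5) diag in \<open>auto simp: diagonal_mat_def\<close>)
    finally show "y $ i * (D *\<^sub>v y) $ i = D $$ (i, i) * (y $ i)\<^sup>2"
      using i by (simp add: power2_eq_square)
  qed simp
  finally show ?thesis unfolding y_def .
qed

text \<open>With at most one diagonal entry of sign \<open>c\<close>, some nonzero combination of \<open>g\<close> and \<open>h\<close>
  has vanishing coordinate there, so the form cannot have sign \<open>c\<close> on it.\<close>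

lemma definite_plane_imp_two_diagonal_entries:
  fixes A :: "real mat" and c :: real
  assumes A: "A \<in> carrier_mat n n" and sim: "similar_mat_wit A D P (transpose_mat P)"
    and diag: "diagonal_mat D" and g: "g \<in> carrier_vec n" and h: "h \<in> carrier_vec n"
    and def: "\<And>s t x. (s, t) \<noteq> (0, 0) \<Longrightarrow> x = s \<cdot>\<^sub>v g + t \<cdot>\<^sub>v h \<Longrightarrow> c * (x \<bullet> (A *\<^sub>v x)) > 0"
  shows "card {i. i < n \<and> c * D $$ (i, i) > 0} \<ge> 2"
proof (rule ccontr)
  define I where "I = {i. i < n \<and> c * D $$ (i, i) > 0}"
  assume "\<not> card {i. i < n \<and> c * D $$ (i, i) > 0} \<ge> 2"
  then have "card I \<le> 1" by (simp add: I_def)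
  moreover have "finite I" by (simp add: I_def)
  ultimately have "\<forall>i\<in>I. \<forall>j\<in>I. i = j"
    by (simp add: card_le_Suc0_iff_eq)
  \<comment> \<open>If \<open>I\<close> is empty, \<open>i0\<close> is arbitrary and possibly out of
    range; its coordinate is used below only for an index in \<open>I\<close>.\<close>
  then obtain i0 where i0: "I \<subseteq> {i0}" by blast
  note sim' = similar_mat_witD2[OF A sim]
  define T where "T = transpose_mat P"
  have T: "T \<in> carrier_mat n n" using sim' by (simp add: T_def)
  \<comment> \<open>One homogeneous linear equation in two unknowns has a nonzero solution.\<close>
  obtain s t :: real where st: "(s, t) \<noteq> (0, 0)" "s * (T *\<^sub>v g) $ i0 + t * (T *\<^sub>v h) $ i0 = 0"
  proof (cases "(T *\<^sub>v g) $ i0 = 0")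
    case True
    then show ?thesis using that[of 1 0] by simp
  next
    case False
    then show ?thesis using that[of "- (T *\<^sub>v h) $ i0" "(T *\<^sub>v g) $ i0"] by simp
  qed
  define x where "x = s \<cdot>\<^sub>v g + t \<cdot>\<^sub>v h"
  have x: "x \<in> carrier_vec n" using g h by (simp add: x_def)
  have Tx: "T *\<^sub>v x = s \<cdot>\<^sub>v (T *\<^sub>v g) + t \<cdot>\<^sub>v (T *\<^sub>v h)"
    unfolding x_def using T g h by (simp add: mult_add_distrib_mat_vec[of _ n n] mult_mat_vec)
  have "c * D $$ (i, i) * ((T *\<^sub>v x) $ i)\<^sup>2 \<le> 0" if "i < n" for i
  proof (cases "i \<in> I")
    case True
    then have "i = i0" using i0 by auto
    then have "(T *\<^sub>v x) $ i = 0" using Tx st(2) that T by simp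
    then show ?thesis by simp
  next
    case False
    then have "c * D $$ (i, i) \<le> 0" using that by (simp add: I_def)
    then show ?thesis by (rule mult_nonpos_nonneg) simp
  qed
  then have "c * (x \<bullet> (A *\<^sub>v x)) \<le> 0"
    unfolding quadratic_form_diagonal[OF A sim diag x] T_def
    by (auto simp: sum_distrib_left mult.assoc intro!: sum_nonpos)
  with def[OF st(1) x_def] show False by simp
qed

text \<open>The preceding lemma with sign factor 1 and -1 yields two positive and two negative
  diagonal entries. Positive, negative and zero entries partition the \<open>n\<close> positions,
  which bounds the zeros. Over \<open>int\<close> the subtraction is not truncated.\<close>

lemma inertia_of_two_definite_planes:
  fixes A :: "real mat"
  assumes A: "A \<in> carrier_mat n n" and sym: "transpose_mat A = A"
    and gp: "gp \<in> carrier_vec n" "hp \<in> carrier_vec n"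
    and pos: "\<And>s t x. (s, t) \<noteq> (0, 0) \<Longrightarrow> x = s \<cdot>\<^sub>v gp + t \<cdot>\<^sub>v hp \<Longrightarrow> x \<bullet> (A *\<^sub>v x) > 0"
    and gm: "gm \<in> carrier_vec n" "hm \<in> carrier_vec n"
    and neg: "\<And>s t x. (s, t) \<noteq> (0, 0) \<Longrightarrow> x = s \<cdot>\<^sub>v gm + t \<cdot>\<^sub>v hm \<Longrightarrow> x \<bullet> (A *\<^sub>v x) < 0"
  shows "i_pos A \<ge> 2 \<and> i_neg A \<ge> 2 \<and> int (i_zero A) \<le> int n - 4"
proof -
  obtain P D where sim: "similar_mat_wit A D P (transpose_mat P)" and diag: "diagonal_mat D"
    using real_spectral_theorem[OF A sym] by blast
  then have sim': "similar_mat A D" by (auto simp: similar_mat_def)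
  note count = sum_order_eigenvalues_diagonal[OF A sim' diag]
  have ip: "i_pos A = card {i. i < n \<and> D $$ (i, i) > 0}"
    and im: "i_neg A = card {i. i < n \<and> D $$ (i, i) < 0}"
    and iz: "i_zero A = card {i. i < n \<and> D $$ (i, i) = 0}"
    unfolding i_pos_def i_neg_def i_zero_def by (rule count)+
  have "i_pos A \<ge> 2"
    using definite_plane_imp_two_diagonal_entries[OF A sim diag gp, of 1] pos by (simp add: ip)
  moreover have "i_neg A \<ge> 2"
    using definite_plane_imp_two_diagonal_entries[OF A sim diag gm, of "-1"] neg by (simp add: im)
  moreover have "i_pos A + i_neg A + i_zero A = n"
  proof -
    let ?S = "\<lambda>Q. {i. i < n \<and> Q (D $$ (i, i))}"
    have "card (?S (\<lambda>d. d > 0) \<union> ?S (\<lambda>d. d < 0) \<union> ?S (\<lambda>d. d = 0)) = i_pos A + i_neg A + i_zero A"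
      unfolding ip im iz by (subst card_Un_disjoint, auto)+
    moreover have "?S (\<lambda>d. d > 0) \<union> ?S (\<lambda>d. d < 0) \<union> ?S (\<lambda>d. d = 0) = {..<n}"
      by auto
    ultimately show ?thesis by simp
  qed
  ultimately show ?thesis by simp
qed

section \<open>A pendant edge and an edge disjoint from it\<close>

lemma edge_eq_doubleton:
  assumes "simple_graph V E" "e \<in> E"
  obtains a b where "e = {a, b}" "a \<noteq> b" "a \<in> V" "b \<in> V"
  using assms unfolding simple_graph_def nsets_def by (auto simp: card_2_iff)

text \<open>A star centred at \<open>y\<close> has at most \<open>card V - 1\<close> edges, so some
  edge avoids \<open>y\<close>. It avoids \<open>x\<close> as well, since the only edge at
  \<open>x\<close> is \<open>{x, y}\<close>.\<close>

lemma pendant_edge_and_disjoint_edge: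
  assumes simple: "simple_graph V E" and card: "card E \<ge> card V" and pend: "pendant_vertex V E x"
  obtains y a b where "distinct [x, y, a, b]" "{x, y} \<in> E" "{a, b} \<in> E"
    "\<And>e. e \<in> E \<Longrightarrow> x \<in> e \<Longrightarrow> e = {x, y}"
proof -
  have V: "finite V" and xV: "x \<in> V"
    using simple pend by (auto simp: simple_graph_def pendant_vertex_def)
  obtain e0 where e0: "{e \<in> E. x \<in> e} = {e0}"
    using pend unfolding pendant_vertex_def by (metis card_1_singletonE)
  then have "e0 \<in> E" "x \<in> e0" by auto
  then obtain y where y: "e0 = {x, y}" "x \<noteq> y" "y \<in> V"
    using edge_eq_doubleton[OF simple, of e0] by (metis doubleton_eq_iff insertE singletonD)
  have only: "e = {x, y}" if "e \<in> E" "x \<in> e" for e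
    using e0 y that by blast
  have "\<exists>e\<in>E. y \<notin> e"
  proof (rule ccontr)
    assume "\<not> ?thesis"
    then have all: "y \<in> e" if "e \<in> E" for e using that by blast
    have "E \<subseteq> (\<lambda>z. {y, z}) ` (V - {y})"
    proof
      fix e assume e: "e \<in> E"
      then obtain a b where "e = {a, b}" "a \<noteq> b" "a \<in> V" "b \<in> V"
        using edge_eq_doubleton[OF simple] by blast
      then show "e \<in> (\<lambda>z. {y, z}) ` (V - {y})"
        using all[OF e] by (auto simp: doubleton_eq_iff)
    qed
    then have "card E \<le> card (V - {y})"
      using V by (meson card_image_le card_mono finite_Diff finite_imageI le_trans)
    also have "\<dots> < card V" using V y by (intro card_Diff1_less)
    finally show False using card by simp
  qed
  then obtain e where e: "e \<in> E" "y \<notin> e" by blast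
  then obtain a b where ab: "e = {a, b}" "a \<noteq> b"
    using edge_eq_doubleton[OF simple] by metis
  have "x \<notin> e" using only e by blast
  then have "distinct [x, y, a, b]" using ab e y by auto
  with e ab \<open>e0 \<in> E\<close> y only that show ?thesis by metis
qed

section \<open>Definite planes for the weighted adjacency form\<close>

text \<open>Matrix entries indexed by vertices instead of positions, so that the form can be
  computed without an enumeration.\<close>

definition weight :: "'a set set \<Rightarrow> ('a set \<Rightarrow> real) \<Rightarrow> 'a \<Rightarrow> 'a \<Rightarrow> real" where
  "weight E w p q = (if {p, q} \<in> E then w {p, q} else 0)"

lemma weight_commute: "weight E w p q = weight E w q p"
  by (simp add: weight_def insert_commute)

lemma adj_matrix_quadratic_form:
  fixes f :: "'a \<Rightarrow> real"
  assumes "distinct vs" and x_def: "x = vec (length vs) (\<lambda>i. f (vs ! i))"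
  shows "x \<bullet> (adj_matrix vs E w *\<^sub>v x) = (\<Sum>p\<in>set vs. \<Sum>q\<in>set vs. f p * weight E w p q * f q)"
proof -
  let ?n = "length vs"
  have "bij_betw ((!) vs) {..<?n} (set vs)"
    using assms(1) by (rule bij_betw_nth) auto
  then have re: "(\<Sum>i<?n. k (vs ! i)) = sum k (set vs)" for k :: "'a \<Rightarrow> real"
    by (rule sum.reindex_bij_betw)
  have "x \<bullet> (adj_matrix vs E w *\<^sub>v x)
      = (\<Sum>i<?n. \<Sum>j<?n. f (vs ! i) * weight E w (vs ! i) (vs ! j) * f (vs ! j))"
    by (auto simp: x_def adj_matrix_def weight_def scalar_prod_def lessThan_atLeast0
        sum_distrib_left mult.assoc intro!: sum.cong)
  also have "\<dots> = (\<Sum>p\<in>set vs. \<Sum>q\<in>set vs. f p * weight E w p q * f q)"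
    using re[of "\<lambda>p. \<Sum>j<?n. f p * weight E w p (vs ! j) * f (vs ! j)"]
      re[of "\<lambda>q. f p * weight E w p q * f q" for p]
    by simp
  finally show ?thesis .
qed

text \<open>The value at the pendant vertex \<open>x\<close> is chosen so as to cancel the cross terms of \<open>y\<close>
  with \<open>a\<close> and \<open>b\<close>: on these vectors the form is \<open>2 * c * s\<^sup>2 + 2 * c * w {a, b} * t\<^sup>2\<close>.\<close>

definition plane_fun ::
    "'a set set \<Rightarrow> ('a set \<Rightarrow> real) \<Rightarrow> 'a \<Rightarrow> 'a \<Rightarrow> 'a \<Rightarrow> 'a \<Rightarrow> real \<Rightarrow> real \<Rightarrow> real \<Rightarrow> 'a \<Rightarrow> real" where
  "plane_fun E w x y a b c s t p =
     (if p = y then s else if p = a then t else if p = b then c * t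
      else if p = x then (c * s - weight E w y a * t - weight E w y b * (c * t)) / w {x, y}
      else 0)"

text \<open>Ensures that the vectors with parameters \<open>s\<close> and \<open>t\<close> are
  exactly the combinations of two fixed ones, that is, a plane as required by the inertia
  criterion.\<close>

lemma plane_fun_linear:
  "plane_fun E w x y a b c s t p
   = s * plane_fun E w x y a b c 1 0 p + t * plane_fun E w x y a b c 0 1 p"
  by (simp add: plane_fun_def add_divide_distrib diff_divide_distrib algebra_simps)

lemma plane_fun_quadratic_form:
  fixes c s t :: real
  assumes simple: "simple_graph V E" and dist: "distinct [x, y, a, b]"
    and xy: "{x, y} \<in> E" and ab: "{a, b} \<in> E" and w: "w {x, y} > 0"
    and only: "\<And>e. e \<in> E \<Longrightarrow> x \<in> e \<Longrightarrow> e = {x, y}"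
    and f_def: "f = plane_fun E w x y a b c s t"
  shows "(\<Sum>p\<in>V. \<Sum>q\<in>V. f p * weight E w p q * f q) = 2 * c * (s\<^sup>2 + w {a, b} * t\<^sup>2)"
proof -
  let ?W = "weight E w" and ?S = "{x, y, a, b}"
  have V: "finite V" and S: "?S \<subseteq> V"
    using simple xy ab by (auto simp: simple_graph_def nsets_def)
  have ne: "x \<noteq> y" "x \<noteq> a" "x \<noteq> b" "y \<noteq> a" "y \<noteq> b" "a \<noteq> b"
    "y \<noteq> x" "a \<noteq> x" "b \<noteq> x" "a \<noteq> y" "b \<noteq> y" "b \<noteq> a"
    using dist by auto
  have f0: "f p = 0" if "p \<notin> ?S" for p using that by (simp add: f_def plane_fun_def)
  have loop: "?W p p = 0" for p
    using simple by (auto simp: weight_def simple_graph_def nsets_def)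
  have xa: "?W x a = 0" "?W x b = 0"
    using only[of "{x, a}"] only[of "{x, b}"] dist by (auto simp: weight_def doubleton_eq_iff)
  have comm: "?W y x = ?W x y" "?W a x = ?W x a" "?W b x = ?W x b" "?W a y = ?W y a"
    "?W b y = ?W y b" "?W b a = ?W a b"
    by (rule weight_commute)+
  \<comment> \<open>\<open>f\<close> vanishes off the four vertices, so both sums shrink to
    \<open>{x, y, a, b}\<close>.\<close>
  have "(\<Sum>p\<in>V. \<Sum>q\<in>V. f p * ?W p q * f q) = (\<Sum>p\<in>V. \<Sum>q\<in>?S. f p * ?W p q * f q)"
    using V S f0 by (intro sum.cong refl sum.mono_neutral_right) auto
  also have "\<dots> = (\<Sum>p\<in>?S. \<Sum>q\<in>?S. f p * ?W p q * f q)"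
    using V S f0 by (intro sum.mono_neutral_right) auto
  \<comment> \<open>All couplings of \<open>y\<close> are gathered in one bracket, which the value
    of \<open>f\<close> at \<open>x\<close> reduces to \<open>c * s\<close>. The edge
    \<open>{a, b}\<close> gets the same sign factor since \<open>f b = c * f a\<close>.\<close>
  also have "\<dots> = 2 * f y * (?W x y * f x + ?W y a * f a + ?W y b * f b) + 2 * ?W a b * f a * f b"
    using ne by (simp add: loop comm xa algebra_simps)
  also have "?W x y * f x + ?W y a * f a + ?W y b * f b = c * s"
    using ne w xy by (simp add: f_def plane_fun_def weight_def[of E w x y])
  also have "2 * f y * (c * s) + 2 * ?W a b * f a * f b = 2 * c * (s\<^sup>2 + w {a, b} * t\<^sup>2)"
    using ne ab
    by (simp add: f_def plane_fun_def weight_def[of E w a b] power2_eq_square algebra_simps)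
  finally show ?thesis .
qed

theorem theorem3p7:
  fixes V :: "'a set" and E :: "'a set set" and w :: "'a set \<Rightarrow> real"
    and vs :: "'a list" and n :: nat
  assumes "weighted_theta_graph V E w"
    and "card V = n"
    and "\<exists>x. pendant_vertex V E x"
    and "distinct vs" and "set vs = V"
  shows "i_pos (adj_matrix vs E w) \<ge> 2
    \<and> i_neg (adj_matrix vs E w) \<ge> 2
    \<and> int (i_zero (adj_matrix vs E w)) \<le> int n - 4"
proof -
  have simple: "simple_graph V E" and w: "\<And>e. e \<in> E \<Longrightarrow> w e > 0" and card: "card E = card V + 1"
    using assms(1)
    by (auto simp: weighted_theta_graph_def weighted_graph_def theta_graph_def bicyclic_def)
  have n: "length vs = n" using assms(2,4,5) distinct_card by fastforce
  obtain x where "pendant_vertex V E x" using assms(3) by blast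
  with card obtain y a b where dist: "distinct [x, y, a, b]" and xy: "{x, y} \<in> E" and ab: "{a, b} \<in> E"
    and only: "\<And>e. e \<in> E \<Longrightarrow> x \<in> e \<Longrightarrow> e = {x, y}"
    using pendant_edge_and_disjoint_edge[OF simple] by (metis le_add1)
  define A where "A = adj_matrix vs E w"
  have A: "A \<in> carrier_mat n n" by (simp add: A_def adj_matrix_def n)
  have sym: "transpose_mat A = A"
    by (rule eq_matI) (auto simp: A_def adj_matrix_def insert_commute)
  \<comment> \<open>\<open>F c s t\<close> lists the values of the plane function along
    \<open>vs\<close>; \<open>c = 1\<close> gives the positive plane and \<open>c = -1\<close> the
    negative one, each spanned by the parameters (1, 0) and (0, 1).\<close>
  define F where "F c s t = vec n (\<lambda>i. plane_fun E w x y a b c s t (vs ! i))" for c s t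
  have F: "F c s t \<in> carrier_vec n" for c s t by (simp add: F_def)
  have lin: "s \<cdot>\<^sub>v F c 1 0 + t \<cdot>\<^sub>v F c 0 1 = F c s t" for c s t
    by (rule eq_vecI) (auto simp: F_def intro: plane_fun_linear[symmetric])
  have form: "F c s t \<bullet> (A *\<^sub>v F c s t) = 2 * c * (s\<^sup>2 + w {a, b} * t\<^sup>2)" for c s t
    using adj_matrix_quadratic_form[OF assms(4) refl, of "plane_fun E w x y a b c s t" E w]
      plane_fun_quadratic_form[where V = V and w = w
        and f = "plane_fun E w x y a b c s t", OF simple dist xy ab w[OF xy] only refl]
    by (simp add: F_def A_def n assms(5))
  have pos: "s\<^sup>2 + w {a, b} * t\<^sup>2 > 0" if "(s, t) \<noteq> (0, 0)" for s t
    using that w[OF ab] by (cases "s = 0") (auto intro: add_pos_nonneg)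
  have "i_pos A \<ge> 2 \<and> i_neg A \<ge> 2 \<and> int (i_zero A) \<le> int n - 4"
  proof (rule inertia_of_two_definite_planes[OF A sym F[of 1 1 0] F[of 1 0 1] _
        F[of "-1" 1 0] F[of "-1" 0 1]])
    fix s t :: real and z assume st: "(s, t) \<noteq> (0, 0)"
    show "z \<bullet> (A *\<^sub>v z) > 0" if "z = s \<cdot>\<^sub>v F 1 1 0 + t \<cdot>\<^sub>v F 1 0 1"
      using pos[OF st] unfolding that lin form by simp
    show "z \<bullet> (A *\<^sub>v z) < 0" if "z = s \<cdot>\<^sub>v F (-1) 1 0 + t \<cdot>\<^sub>v F (-1) 0 1"
      unfolding that lin form using pos[OF st] by (rule mult_neg_pos[rotated]) simp
  qed
  then show ?thesis unfolding A_def .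
qed

end
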